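(* Let $F,G:\mathbb{N}^{\star}\to\mathbb{C}$ be completely multiplicative functions, and let $\sigma\in\mathbb{R}$ be such that the Dirichlet series $D(F,s)$, $D(G,s)$, $D(F\star G,s)$, $D(F\times G,2s)$ and $D(F\,\square\,G,s)$ all converge for every $s\in\mathbb{C}$ with $\Re(s)>\sigma$. Then for every $s\in\mathbb{C}$ with $\Re(s)>\sigma$, $$D(F\star G,s)=D(F\times G,2s)\cdot D(F\,\square\,G,s).$$
   Context: $\mathbb{N}^{\star}$ is the set of positive integers. $F:\mathbb{N}^{\star}\to\mathbb{C}$ is completely multiplicative if $F(1)=1$ and $F(ab)=F(a)F(b)$ for all $a,b\in\mathbb{N}^{\star}$. For functions $F,G$ on $\mathbb{N}^{\star}$: $[F\star G](n)=\sum_{ab=n}F(a)G(b)$ (Dirichlet convolution); $[F\times G](n)=F(n)G(n)$; $[F\,\square\,G](n)=\sum_{ab=n,\ \gcd(a,b)=1}F(a)G(b)$. The Dirichlet series of $F$ is $D(F,s)=\sum_{n=1}^{\infty}F(n)n^{-s}$, considered for $\Re(s)>\sigma$, a region where it converges. *)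

theory Defs
  imports "HOL-Analysis.Analysis"
begin

text \<open>
  A function on the positive integers is represented by a function on \<^typ>\<open>nat\<close> whose value at
  \<open>0\<close> is irrelevant: no definition below depends on it.
\<close>

definition completely_multiplicative :: "(nat \<Rightarrow> complex) \<Rightarrow> bool" where
  "completely_multiplicative F \<longleftrightarrow>
     F 1 = 1 \<and> (\<forall>a b. a > 0 \<longrightarrow> b > 0 \<longrightarrow> F (a * b) = F a * F b)"

text \<open>
  In the two convolutions the conditions \<open>a > 0\<close> and \<open>b > 0\<close> only matter at the argument \<open>0\<close>.
\<close>

definition dirichlet_conv :: "(nat \<Rightarrow> complex) \<Rightarrow> (nat \<Rightarrow> complex) \<Rightarrow> nat \<Rightarrow> complex" where
  "dirichlet_conv F G n = (\<Sum>(a, b)\<in>{(a, b). a > 0 \<and> b > 0 \<and> a * b = n}. F a * G b)"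

definition pointwise_prod :: "(nat \<Rightarrow> complex) \<Rightarrow> (nat \<Rightarrow> complex) \<Rightarrow> nat \<Rightarrow> complex" where
  "pointwise_prod F G n = F n * G n"

definition unitary_conv :: "(nat \<Rightarrow> complex) \<Rightarrow> (nat \<Rightarrow> complex) \<Rightarrow> nat \<Rightarrow> complex" where
  "unitary_conv F G n =
     (\<Sum>(a, b)\<in>{(a, b). a > 0 \<and> b > 0 \<and> a * b = n \<and> gcd a b = 1}. F a * G b)"

text \<open>
  The \<open>k\<close>-th term belongs to the integer \<open>Suc k\<close>, so that the sums start at \<open>1\<close>.
  Convergence is convergence of the partial sums, not absolute convergence.
\<close>

definition dirichlet_term :: "(nat \<Rightarrow> complex) \<Rightarrow> complex \<Rightarrow> nat \<Rightarrow> complex" where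
  "dirichlet_term F s k = F (Suc k) * of_nat (Suc k) powr (- s)"

definition dirichlet_converges :: "(nat \<Rightarrow> complex) \<Rightarrow> complex \<Rightarrow> bool" where
  "dirichlet_converges F s \<longleftrightarrow> summable (dirichlet_term F s)"

definition dirichlet_series :: "(nat \<Rightarrow> complex) \<Rightarrow> complex \<Rightarrow> complex" where
  "dirichlet_series F s = (\<Sum>k. dirichlet_term F s k)"

end

theory Submission
  imports Defs "HOL-Complex_Analysis.Complex_Analysis"
begin

text \<open>
  Every pair \<open>(a, b)\<close> of positive integers is uniquely \<open>(d * x, d * y)\<close> with \<open>x\<close>, \<open>y\<close> coprime,
  namely with \<open>d = gcd a b\<close>.  For completely multiplicative \<open>F\<close> and \<open>G\<close> the summand
  \<open>F a * G b * (a * b) powr -s\<close> of \<open>D(F \<star> G, s)\<close> then splits into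
  \<open>F d * G d * d powr -2s\<close> times \<open>F x * G y * (x * y) powr -s\<close>; summing the first factor over \<open>d\<close>
  gives \<open>D(F \<times> G, 2s)\<close>, and summing the second over coprime pairs gives \<open>D(F \<box> G, s)\<close>.

  This rearrangement is justified by absolute convergence of \<open>D(F, s)\<close> and \<open>D(G, s)\<close>, while on
  \<open>Re s > \<sigma>\<close> convergence may be merely conditional.  Two classical facts about Dirichlet series close
  the gap.  Convergence at \<open>s0\<close> implies absolute convergence for \<open>Re s > Re s0 + 1\<close>
  (\<open>dirichlet_term_abs_summable\<close>), so the identity holds on a smaller half-plane
  (\<open>dirichlet_conv_series_if_abs_summable\<close>).  And a Dirichlet series is holomorphic on its open
  half-plane of convergence (\<open>dirichlet_series_holomorphic\<close>), so both sides of the identity are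
  holomorphic for \<open>Re s > \<sigma>\<close> and agree there by uniqueness of analytic
  continuation.
\<close>

section \<open>Summation by parts for Dirichlet series\<close>

lemma norm_of_nat_Suc_powr: "norm (of_nat (Suc k) powr (w :: complex)) = real (Suc k) powr Re w"
  by (subst norm_powr_real_powr) auto

text \<open>
  Mean value inequality for \<open>t powr -w\<close>, whose derivative has norm
  \<open>norm w * t powr (-Re w - 1)\<close>, between two consecutive integers.  Bounding \<open>Re w\<close> from below by
  \<open>\<delta>\<close> makes the estimate uniform in \<open>w\<close>; its right side is summable over \<open>k\<close> when \<open>\<delta> > 0\<close>.
\<close>
lemma norm_powr_Suc_diff_le:
  assumes "0 \<le> \<delta>" "\<delta> \<le> Re w"
  shows "norm (of_nat (Suc k) powr (-w) - of_nat (Suc (Suc k)) powr (-w))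
           \<le> norm w * real (Suc k) powr (-\<delta> - 1)"
proof -
  have "norm ((\<lambda>t::complex. t powr (-w)) (of_nat (Suc k)) - (\<lambda>t. t powr (-w)) (of_nat (Suc (Suc k))))
      \<le> norm w * real (Suc k) powr (-\<delta> - 1) * norm (of_nat (Suc k) - of_nat (Suc (Suc k)) :: complex)"
    \<comment> \<open>The real segment is used, not a complex half-plane: for complex \<open>t\<close> the norm of
      \<open>t powr -w\<close> depends on the argument of \<open>t\<close> as well.\<close>
  proof (rule field_differentiable_bound[where S = "of_real ` {real (Suc k)..real (Suc (Suc k))}"
        and f' = "\<lambda>t. - w * t powr (- w - 1)"])
    show "convex (of_real ` {real (Suc k)..real (Suc (Suc k))} :: complex set)"
      by (intro convex_linear_image) (auto intro: bounded_linear.linear bounded_linear_of_real)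
    fix z :: complex assume "z \<in> of_real ` {real (Suc k)..real (Suc (Suc k))}"
    then obtain x where x: "z = of_real x" "real (Suc k) \<le> x" by auto
    have "x > 0" using x(2) by simp
    then have "z \<notin> \<real>\<^sub>\<le>\<^sub>0" using x by (auto simp: complex_nonpos_Reals_iff)
    then show "((\<lambda>t. t powr - w) has_field_derivative - w * z powr (- w - 1))
            (at z within of_real ` {real (Suc k)..real (Suc (Suc k))})"
      by (intro has_field_derivative_at_within[OF has_field_derivative_powr])
    have "x powr (- Re w - 1) \<le> real (Suc k) powr (-Re w - 1)"
      using x assms by (intro powr_mono2') auto
    also have "\<dots> \<le> real (Suc k) powr (-\<delta> - 1)"
      using assms by (intro powr_mono) auto
    finally show "norm (- w * z powr (- w - 1)) \<le> norm w * real (Suc k) powr (-\<delta> - 1)"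
      using \<open>x > 0\<close> x by (auto simp: norm_mult norm_powr_real_powr intro!: mult_left_mono)
  qed (auto intro: image_eqI[where x = "real (Suc k)"] image_eqI[where x = "real (Suc (Suc k))"])
  then show ?thesis by (simp add: norm_minus_commute)
qed

lemma summable_Suc_powr: "r < -1 \<Longrightarrow> summable (\<lambda>k. real (Suc k) powr r)"
  using summable_real_powr_iff[of r] summable_Suc_iff[of "\<lambda>n. real n powr r"] by simp

lemma abel_summation:
  fixes a b :: "nat \<Rightarrow> 'a::comm_ring"
  shows "(\<Sum>k<N. a k * b k) =
     (\<Sum>k<N. (\<Sum>j<Suc k. a j) * (b k - b (Suc k))) + (\<Sum>j<N. a j) * b N"
  by (induction N) (simp_all add: algebra_simps)

lemma dirichlet_term_shift:
  "dirichlet_term f s k = dirichlet_term f s0 k * of_nat (Suc k) powr (-(s - s0))"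
proof -
  have "(of_nat (Suc k) :: complex) powr (-s) =
        of_nat (Suc k) powr (-s0) * of_nat (Suc k) powr (-(s - s0))"
    by (subst powr_add[symmetric]) (simp add: algebra_simps)
  then show ?thesis by (simp add: dirichlet_term_def)
qed

text \<open>
  Summand of the Abel-summed series: a partial sum of the series at \<open>s0\<close>, which does not involve \<open>s\<close>,
  times a difference of consecutive values of \<open>n powr -(s - s0)\<close>.  If the
  Dirichlet series converges at \<open>s0\<close>, even conditionally, the series of these terms converges
  absolutely and locally uniformly for \<open>Re s > Re s0\<close>.
\<close>
definition abel_term :: "(nat \<Rightarrow> complex) \<Rightarrow> complex \<Rightarrow> nat \<Rightarrow> complex \<Rightarrow> complex" where
  "abel_term f s0 k s = (\<Sum>j<Suc k. dirichlet_term f s0 j) *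
     (of_nat (Suc k) powr (-(s - s0)) - of_nat (Suc (Suc k)) powr (-(s - s0)))"

lemma dirichlet_partial_sums_bounded:
  assumes "dirichlet_converges f s0"
  obtains M where "0 \<le> M" "\<And>N. norm (\<Sum>j<N. dirichlet_term f s0 j) \<le> M"
proof -
  have "Bseq (\<lambda>N. \<Sum>j<N. dirichlet_term f s0 j)"
    using assms unfolding dirichlet_converges_def
    by (intro convergent_imp_Bseq) (simp add: summable_iff_convergent)
  then show ?thesis using that by (auto elim!: BseqE intro: less_imp_le)
qed

lemma norm_abel_term_le:
  assumes "\<And>N. norm (\<Sum>j<N. dirichlet_term f s0 j) \<le> M" "0 \<le> \<delta>" "\<delta> \<le> Re (s - s0)"
    "norm (s - s0) \<le> R"
  shows "norm (abel_term f s0 k s) \<le> M * (R * real (Suc k) powr (-\<delta> - 1))"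
proof -
  have "norm (of_nat (Suc k) powr (-(s - s0)) - of_nat (Suc (Suc k)) powr (-(s - s0)))
      \<le> norm (s - s0) * real (Suc k) powr (-\<delta> - 1)"
    using assms by (intro norm_powr_Suc_diff_le) auto
  also have "\<dots> \<le> R * real (Suc k) powr (-\<delta> - 1)"
    using assms by (intro mult_right_mono) auto
  finally show ?thesis
    unfolding abel_term_def norm_mult
    using assms(1) order_trans[OF norm_ge_zero assms(1)] by (intro mult_mono norm_ge_zero)
qed

text \<open>
  Partial sums of the two series differ by the boundary term of the summation by parts, a bounded
  partial sum at \<open>s0\<close> times \<open>(N + 1) powr -(s - s0)\<close>, which tends to \<open>0\<close>.
\<close>
lemma abel_term_sums_dirichlet_series:
  assumes conv: "dirichlet_converges f s0" and s: "Re s0 < Re s"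
  shows "(\<lambda>k. abel_term f s0 k s) sums dirichlet_series f s"
proof -
  define A where "A N = (\<Sum>j<N. dirichlet_term f s0 j)" for N
  define b where "b k = (of_nat (Suc k) :: complex) powr (-(s - s0))" for k
  obtain M where M: "0 \<le> M" "\<And>N. norm (A N) \<le> M"
    using dirichlet_partial_sums_bounded[OF conv] unfolding A_def by blast
  have "summable (\<lambda>k. abel_term f s0 k s)"
  proof (rule summable_comparison_test)
    show "\<exists>N. \<forall>k\<ge>N. norm (abel_term f s0 k s)
        \<le> M * (norm (s - s0) * real (Suc k) powr (-Re (s - s0) - 1))"
      using M s by (intro exI allI impI norm_abel_term_le) (auto simp: A_def)
    show "summable (\<lambda>k. M * (norm (s - s0) * real (Suc k) powr (-Re (s - s0) - 1)))"
      using s by (intro summable_mult summable_Suc_powr) auto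
  qed
  then have *: "(\<lambda>N. \<Sum>k<N. abel_term f s0 k s) \<longlonglongrightarrow> (\<Sum>k. abel_term f s0 k s)"
    by (rule summable_LIMSEQ)
  have "(\<lambda>N. A N * b N) \<longlonglongrightarrow> 0"
  proof (rule Lim_null_comparison)
    show "\<forall>\<^sub>F N in sequentially. norm (A N * b N) \<le> M * real (Suc N) powr (-Re (s - s0))"
      unfolding norm_mult b_def norm_of_nat_Suc_powr using M
      by (intro always_eventually allI mult_mono) auto
    have "(\<lambda>N. real (Suc N) powr (-Re (s - s0))) \<longlonglongrightarrow> 0"
      using s by (intro tendsto_neg_powr filterlim_compose[OF filterlim_real_sequentially filterlim_Suc]) auto
    then show "(\<lambda>N. M * real (Suc N) powr (-Re (s - s0))) \<longlonglongrightarrow> 0"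
      by (rule tendsto_mult_right_zero)
  qed
  with * have "(\<lambda>N. (\<Sum>k<N. abel_term f s0 k s) + A N * b N) \<longlonglongrightarrow> (\<Sum>k. abel_term f s0 k s) + 0"
    by (rule tendsto_add)
  moreover have "(\<Sum>k<N. abel_term f s0 k s) + A N * b N = (\<Sum>k<N. dirichlet_term f s k)" for N
    unfolding dirichlet_term_shift[of f s _ s0] A_def b_def abel_term_def
    by (rule abel_summation[symmetric])
  ultimately have "dirichlet_term f s sums (\<Sum>k. abel_term f s0 k s)"
    by (simp add: sums_def)
  then have "dirichlet_series f s = (\<Sum>k. abel_term f s0 k s)"
    unfolding dirichlet_series_def by (rule sums_unique[symmetric])
  with \<open>summable _\<close> show ?thesis by (simp add: summable_sums)
qed

section \<open>Holomorphy and absolute convergence\<close>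

text \<open>
  On a disc whose points have real part at least \<open>Re s0 + \<delta>\<close> the Abel-summed series is dominated by
  a constant multiple of the sum of \<open>(k + 1) powr (-\<delta> - 1)\<close>; its partial sums are holomorphic and
  converge uniformly there, hence so is the limit.
\<close>
lemma dirichlet_series_holomorphic_right_of:
  assumes conv: "dirichlet_converges f s0"
  shows "dirichlet_series f holomorphic_on {s. Re s > Re s0}"
proof (rule holomorphic_uniform_sequence)
  show "open {s. Re s > Re s0}" by (rule open_halfspace_Re_gt)
  show "(\<lambda>s. \<Sum>k<n. abel_term f s0 k s) holomorphic_on {s. Re s > Re s0}" for n
    unfolding abel_term_def
    by (intro holomorphic_intros) (auto simp: complex_nonpos_Reals_iff)
  fix x assume "x \<in> {s. Re s > Re s0}"
  then have x: "Re s0 < Re x" by simp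
  \<comment> \<open>Half the distance to the boundary line serves both as radius of the disc and as distance of
    the disc from that line.\<close>
  define \<delta> where "\<delta> = (Re x - Re s0) / 2"
  have \<delta>: "\<delta> > 0" using x by (simp add: \<delta>_def)
  obtain M where M: "0 \<le> M" "\<And>N. norm (\<Sum>j<N. dirichlet_term f s0 j) \<le> M"
    using dirichlet_partial_sums_bounded[OF conv] by blast
  have near: "\<delta> \<le> Re (s - s0)" "norm (s - s0) \<le> norm (x - s0) + \<delta>" if "s \<in> cball x \<delta>" for s
  proof -
    have d: "norm (x - s) \<le> \<delta>" using that by (simp add: dist_norm)
    have "Re (x - s) \<le> \<delta>" using d complex_Re_le_cmod[of "x - s"] by linarith
    then show "\<delta> \<le> Re (s - s0)" by (simp add: \<delta>_def field_simps)
    have "norm (s - s0) \<le> norm (x - s0) + norm (x - s)"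
      using norm_triangle_ineq4[of "x - s0" "x - s"] by simp
    with d show "norm (s - s0) \<le> norm (x - s0) + \<delta>" by simp
  qed
  have sub: "cball x \<delta> \<subseteq> {s. Re s > Re s0}" using near(1) \<delta> by fastforce
  have "uniform_limit (cball x \<delta>) (\<lambda>n s. \<Sum>k<n. abel_term f s0 k s)
          (\<lambda>s. \<Sum>k. abel_term f s0 k s) sequentially"
  proof (rule Weierstrass_m_test)
    show "norm (abel_term f s0 k s) \<le> M * ((norm (x - s0) + \<delta>) * real (Suc k) powr (-\<delta> - 1))"
      if "s \<in> cball x \<delta>" for k s
      using M \<delta> near[OF that] by (intro norm_abel_term_le) auto
    show "summable (\<lambda>k. M * ((norm (x - s0) + \<delta>) * real (Suc k) powr (-\<delta> - 1)))"
      using \<delta> by (intro summable_mult summable_Suc_powr) auto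
  qed
  also have "?this \<longleftrightarrow> uniform_limit (cball x \<delta>) (\<lambda>n s. \<Sum>k<n. abel_term f s0 k s)
          (dirichlet_series f) sequentially"
    using sub by (intro uniform_limit_cong' sums_unique[symmetric] refl
        abel_term_sums_dirichlet_series[OF conv]) auto
  finally show "\<exists>d>0. cball x d \<subseteq> {s. Re s > Re s0} \<and>
      uniform_limit (cball x d) (\<lambda>n s. \<Sum>k<n. abel_term f s0 k s) (dirichlet_series f) sequentially"
    using \<delta> sub by blast
qed

lemma dirichlet_series_holomorphic:
  assumes conv: "\<And>s. Re s > \<sigma> \<Longrightarrow> dirichlet_converges f s"
  shows "dirichlet_series f holomorphic_on {s. Re s > \<sigma>}"
proof -
  have "dirichlet_series f holomorphic_on (\<Union>s0\<in>{s. Re s > \<sigma>}. {s. Re s > Re s0})"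
    using assms by (intro holomorphic_on_UN_open dirichlet_series_holomorphic_right_of
        open_halfspace_Re_gt) auto
  also have "(\<Union>s0\<in>{s. Re s > \<sigma>}. {s. Re s > Re s0}) = {s. Re s > \<sigma>}"
  proof (intro equalityI subsetI)
    fix s assume "s \<in> {s. Re s > \<sigma>}"
    then obtain t where "\<sigma> < t" "t < Re s" using dense by auto
    then show "s \<in> (\<Union>s0\<in>{s. Re s > \<sigma>}. {s. Re s > Re s0})"
      by (intro UN_I[of "of_real t"]) auto
  qed auto
  finally show ?thesis .
qed

text \<open>
  The terms at \<open>s0\<close> are bounded, so the terms at \<open>s\<close> are \<open>O((k + 1) powr -Re (s - s0))\<close>.
\<close>
lemma dirichlet_term_abs_summable:
  assumes conv: "dirichlet_converges f s0" and s: "Re s > Re s0 + 1"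
  shows "summable (\<lambda>k. norm (dirichlet_term f s k))"
proof -
  have "Bseq (dirichlet_term f s0)"
    using conv summable_LIMSEQ_zero unfolding dirichlet_converges_def
    by (blast intro: convergent_imp_Bseq convergentI)
  then obtain M where M: "\<And>k. norm (dirichlet_term f s0 k) \<le> M"
    unfolding Bseq_def by blast
  show ?thesis
  proof (rule summable_comparison_test)
    show "\<exists>N. \<forall>k\<ge>N. norm (norm (dirichlet_term f s k)) \<le> M * real (Suc k) powr (-Re (s - s0))"
      unfolding dirichlet_term_shift[of f s _ s0] norm_mult norm_of_nat_Suc_powr
      using M by (auto intro!: exI[of _ 0] mult_right_mono)
    show "summable (\<lambda>k. M * real (Suc k) powr (-Re (s - s0)))"
      using s by (intro summable_mult summable_Suc_powr) auto
  qed
qed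

section \<open>The identity under absolute convergence\<close>

lemma bij_betw_Suc_positive: "bij_betw Suc UNIV {0<..}"
  by (rule bij_betwI[where g = "\<lambda>n. n - 1"]) auto

lemma dirichlet_series_eq_infsum:
  assumes "(\<lambda>n. f n * of_nat n powr (-s)) summable_on {0<..}"
  shows "dirichlet_series f s = (\<Sum>\<^sub>\<infinity>n\<in>{0<..}. f n * of_nat n powr (-s))"
proof -
  have "(dirichlet_term f s has_sum (\<Sum>\<^sub>\<infinity>n\<in>{0<..}. f n * of_nat n powr (-s))) UNIV"
    unfolding dirichlet_term_def[abs_def]
    using has_sum_reindex_bij_betw[OF bij_betw_Suc_positive, of "\<lambda>n. f n * of_nat n powr (-s)"]
      has_sum_infsum[OF assms] by simp
  then show ?thesis
    unfolding dirichlet_series_def using has_sum_imp_sums sums_unique by metis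
qed

text \<open>
  Grouping a sum over pairs by the product \<open>a * b\<close>, which is constant on each of the finite groups.
  All positive pairs as \<open>R\<close> give the Dirichlet convolution, the coprime ones give the unitary
  convolution.
\<close>
lemma dirichlet_series_sum_over_factorisations:
  assumes R: "R \<subseteq> {0<..} \<times> {0<..}"
    and sm: "(\<lambda>(a, b). F a * G b * of_nat (a * b) powr (-s)) summable_on R"
  shows "dirichlet_series (\<lambda>n. \<Sum>(a, b)\<in>{(a, b)\<in>R. a * b = n}. F a * G b) s =
           (\<Sum>\<^sub>\<infinity>(a, b)\<in>R. F a * G b * of_nat (a * b) powr (-s))"
proof -
  define h where "h = (\<lambda>(a, b). F a * G b * (of_nat (a * b) :: complex) powr (-s))"
  define B where "B n = {(a, b)\<in>R. a * b = n}" for n :: nat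
  have bij: "bij_betw snd (Sigma {0<..} B) R"
    using R by (intro bij_betwI[where g = "\<lambda>p. (fst p * snd p, p)"]) (auto simp: B_def)
  have fin: "finite (B n)" if "n > 0" for n
  proof (rule finite_subset)
    show "B n \<subseteq> {0..n} \<times> {0..n}"
      using that by (auto simp: B_def)
  qed simp
  have smS: "(\<lambda>(n, p). h p) summable_on Sigma {0<..} B"
    using summable_on_reindex_bij_betw[OF bij, of h] sm by (simp add: h_def case_prod_unfold)
  have inner: "infsum h (B n) = (\<Sum>(a, b)\<in>B n. F a * G b) * of_nat n powr (-s)" if "n > 0" for n
    using fin[OF that] by (auto simp: sum_distrib_right B_def h_def intro!: sum.cong)
  have "(\<lambda>n. infsum h (B n)) summable_on {0<..}"
    using summable_on_Sigma_banach[OF smS] by simp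
  then have sm1: "(\<lambda>n. (\<Sum>(a, b)\<in>B n. F a * G b) * of_nat n powr (-s)) summable_on {0<..}"
    by (rule summable_on_cong[THEN iffD1, rotated]) (simp add: inner)
  have "infsum h R = (\<Sum>\<^sub>\<infinity>(n, p)\<in>Sigma {0<..} B. h p)"
    using infsum_reindex_bij_betw[OF bij, of h] by (simp add: case_prod_unfold)
  also have "\<dots> = (\<Sum>\<^sub>\<infinity>n\<in>{0<..}. infsum h (B n))"
    using infsum_Sigma'_banach[OF smS] by simp
  also have "\<dots> = (\<Sum>\<^sub>\<infinity>n\<in>{0<..}. (\<Sum>(a, b)\<in>B n. F a * G b) * of_nat n powr (-s))"
    using inner by (intro infsum_cong) auto
  finally show ?thesis
    using dirichlet_series_eq_infsum[OF sm1] by (simp add: B_def h_def)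
qed

lemma bij_betw_scale_coprime_pairs:
  "bij_betw (\<lambda>(d, (x, y)). (d * x, d * y))
     ({0<..} \<times> {(x, y). 0 < x \<and> 0 < y \<and> gcd x y = 1}) ({0<..} \<times> {0<..} :: (nat \<times> nat) set)"
proof (rule bij_betwI[where g = "\<lambda>(a, b). (gcd a b, (a div gcd a b, b div gcd a b))"])
  fix z :: "nat \<times> (nat \<times> nat)"
  assume "z \<in> {0<..} \<times> {(x, y). 0 < x \<and> 0 < y \<and> gcd x y = 1}"
  then obtain d x y where "z = (d, (x, y))" "0 < d" "gcd x y = 1" by auto
  then show "(case case z of (d, (x, y)) \<Rightarrow> (d * x, d * y) of
      (a, b) \<Rightarrow> (gcd a b, (a div gcd a b, b div gcd a b))) = z"
    using gcd_mult_distrib_nat[of d x y] by simp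
qed (auto simp: div_gcd_coprime div_greater_zero_iff simp flip: coprime_iff_gcd_eq_1
      intro: gcd_le1_nat gcd_le2_nat)

text \<open>
  With \<open>P\<close> the positive pairs and \<open>Q\<close> the coprime ones, the double series over \<open>P\<close> converges
  absolutely as the product of \<open>D(F, s)\<close> and \<open>D(G, s)\<close>.  The other two series are subseries of it:
  restriction to \<open>Q\<close> gives the unitary convolution, restriction to the diagonal gives
  \<open>D(F \<times> G, 2s)\<close>.  The bijection of \<open>{0<..} \<times> Q\<close> with \<open>P\<close> by scaling turns the sum over \<open>P\<close> into a
  product.
\<close>
lemma dirichlet_conv_series_if_abs_summable:
  assumes F: "completely_multiplicative F" and G: "completely_multiplicative G"
    and absF: "summable (\<lambda>k. norm (dirichlet_term F s k))"
    and absG: "summable (\<lambda>k. norm (dirichlet_term G s k))"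
  shows "dirichlet_series (dirichlet_conv F G) s =
    dirichlet_series (pointwise_prod F G) (2 * s) * dirichlet_series (unitary_conv F G) s"
proof -
  define P where "P = ({0<..} \<times> {0<..} :: (nat \<times> nat) set)"
  define Q where "Q = {(x, y). 0 < x \<and> 0 < y \<and> gcd x y = (1::nat)}"
  define h where "h = (\<lambda>(a, b). F a * G b * (of_nat (a * b) :: complex) powr (-s))"
  define k where "k n = pointwise_prod F G n * (of_nat n :: complex) powr (-(2 * s))" for n
  have powr_mult_nat: "of_nat (a * b) powr w = of_nat a powr w * (of_nat b powr w :: complex)"
    for a b :: nat and w
    using powr_times_real[of "of_nat a" "of_nat b" w] by simp
  have sq: "of_nat (d * d) powr (-s) = (of_nat d :: complex) powr (-(2 * s))" for d
    unfolding powr_mult_nat powr_add[symmetric] by simp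
  have abs_pos: "(\<lambda>n. norm (f n * of_nat n powr (-s))) summable_on {0<..}"
    if "summable (\<lambda>k. norm (dirichlet_term f s k))" for f
  proof -
    have "(\<lambda>k. norm (dirichlet_term f s k)) summable_on UNIV"
      using that by (intro norm_summable_imp_summable_on) simp
    then show ?thesis
      using summable_on_reindex_bij_betw[OF bij_betw_Suc_positive,
          of "\<lambda>n. norm (f n * of_nat n powr (-s))"]
      by (simp add: dirichlet_term_def)
  qed
  have h_split: "h (a, b) = (F a * of_nat a powr (-s)) * (G b * of_nat b powr (-s))" for a b
    unfolding h_def prod.case powr_mult_nat by (simp add: mult_ac)
  have "(\<lambda>p. norm (h p)) summable_on P"
    unfolding P_def Infinite_Sum.abs_summable_on_Sigma_iff h_split norm_mult[of "F _ * _"]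
    using abs_pos[OF absF] abs_pos[OF absG]
    by (auto simp: infsum_cmult_right' abs_mult intro: summable_on_cmult_right summable_on_cmult_left)
  then have hP: "h summable_on P" by (rule abs_summable_summable)
  have hQ: "h summable_on Q" by (rule summable_on_subset_banach[OF hP]) (auto simp: P_def Q_def)
  have k: "k d = h (d, d)" for d
    by (simp add: k_def h_def pointwise_prod_def sq del: of_nat_mult)
  have "h summable_on (\<lambda>d. (d, d)) ` {0<..}"
    by (rule summable_on_subset_banach[OF hP]) (auto simp: P_def)
  then have ksum: "k summable_on {0<..}"
    by (subst (asm) summable_on_reindex) (auto simp: inj_on_def o_def k[symmetric])
  have factor: "h (d * x, d * y) = k d * h (x, y)" if "d > 0" "x > 0" "y > 0" for d x y
  proof -
    have "F (d * x) = F d * F x" "G (d * y) = G d * G y"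
      using F G that by (auto simp: completely_multiplicative_def)
    moreover have "of_nat ((d * x) * (d * y)) powr (-s) =
        of_nat d powr (-(2 * s)) * (of_nat (x * y) powr (-s) :: complex)"
      unfolding sq[symmetric] powr_mult_nat by (simp add: mult_ac)
    ultimately show ?thesis
      by (simp add: h_def k_def pointwise_prod_def mult_ac del: of_nat_mult)
  qed
  note bij = bij_betw_scale_coprime_pairs[folded P_def Q_def]
  have scale: "h (case z of (d, x, y) \<Rightarrow> (d * x, d * y)) = (case z of (d, q) \<Rightarrow> k d * h q)"
    if "z \<in> {0<..} \<times> Q" for z
    using that factor by (auto simp: Q_def)
  have smT: "(\<lambda>(d, q). k d * h q) summable_on {0<..} \<times> Q"
    using hP summable_on_reindex_bij_betw[OF bij, of h] scale by (simp cong: summable_on_cong)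
  have "infsum h P = (\<Sum>\<^sub>\<infinity>(d, q)\<in>{0<..} \<times> Q. k d * h q)"
    using infsum_reindex_bij_betw[OF bij, of h] scale by (simp cong: infsum_cong)
  also have "\<dots> = (\<Sum>\<^sub>\<infinity>d\<in>{0<..}. \<Sum>\<^sub>\<infinity>q\<in>Q. k d * h q)"
    using infsum_Sigma'_banach[OF smT] by simp
  also have "\<dots> = infsum k {0<..} * infsum h Q"
    by (simp add: infsum_cmult_right' infsum_cmult_left')
  finally have main: "infsum h P = infsum k {0<..} * infsum h Q" .
  have "dirichlet_conv F G = (\<lambda>n. \<Sum>(a, b)\<in>{(a, b)\<in>P. a * b = n}. F a * G b)"
    unfolding dirichlet_conv_def[abs_def] P_def by (intro ext sum.cong) auto
  then have conv: "dirichlet_series (dirichlet_conv F G) s = infsum h P"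
    using dirichlet_series_sum_over_factorisations[of P F G s] hP by (simp add: h_def P_def)
  have "unitary_conv F G = (\<lambda>n. \<Sum>(a, b)\<in>{(a, b)\<in>Q. a * b = n}. F a * G b)"
    unfolding unitary_conv_def[abs_def] Q_def by (intro ext sum.cong) auto
  moreover have "Q \<subseteq> {0<..} \<times> {0<..}" by (auto simp: Q_def)
  ultimately have unit: "dirichlet_series (unitary_conv F G) s = infsum h Q"
    using dirichlet_series_sum_over_factorisations[of Q F G s] hQ by (simp add: h_def)
  have "dirichlet_series (pointwise_prod F G) (2 * s) = infsum k {0<..}"
    using dirichlet_series_eq_infsum[of "pointwise_prod F G" "2 * s"] ksum by (simp add: k_def[abs_def])
  with main conv unit show ?thesis by simp
qed

section \<open>Continuation to the half-plane of convergence\<close>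

theorem theorem4p2:
  fixes F G :: "nat \<Rightarrow> complex" and \<sigma> :: real
  assumes "completely_multiplicative F"
    and "completely_multiplicative G"
    and "\<And>s. Re s > \<sigma> \<Longrightarrow> dirichlet_converges F s"
    and "\<And>s. Re s > \<sigma> \<Longrightarrow> dirichlet_converges G s"
    and "\<And>s. Re s > \<sigma> \<Longrightarrow> dirichlet_converges (dirichlet_conv F G) s"
    and "\<And>s. Re s > \<sigma> \<Longrightarrow> dirichlet_converges (pointwise_prod F G) (2 * s)"
    and "\<And>s. Re s > \<sigma> \<Longrightarrow> dirichlet_converges (unitary_conv F G) s"
  shows "\<forall>s. Re s > \<sigma> \<longrightarrow>
           dirichlet_series (dirichlet_conv F G) s =
             dirichlet_series (pointwise_prod F G) (2 * s) * dirichlet_series (unitary_conv F G) s"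
proof (intro allI impI)
  fix s :: complex assume s: "Re s > \<sigma>"
  \<comment> \<open>\<open>\<sigma>\<close> itself need not be a point of convergence; convergence at \<open>\<sigma> + 1\<close> is known and gives
    absolute convergence beyond \<open>\<sigma> + 2\<close>.\<close>
  let ?H = "{s. Re s > \<sigma>}" and ?A = "{s. Re s > \<sigma> + 2}"
  have "dirichlet_converges (pointwise_prod F G) w" if "Re w > 2 * \<sigma>" for w
    using assms(6)[of "w / 2"] that by simp
  then have "dirichlet_series (pointwise_prod F G) holomorphic_on {w. Re w > 2 * \<sigma>}"
    by (rule dirichlet_series_holomorphic)
  then have "(dirichlet_series (pointwise_prod F G) \<circ> (\<lambda>s. 2 * s)) holomorphic_on ?H"
    by (rule holomorphic_on_compose_gen[rotated]) (auto intro: holomorphic_intros)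
  then have P: "(\<lambda>s. dirichlet_series (pointwise_prod F G) (2 * s)) holomorphic_on ?H"
    by (simp add: o_def)
  show "dirichlet_series (dirichlet_conv F G) s =
      dirichlet_series (pointwise_prod F G) (2 * s) * dirichlet_series (unitary_conv F G) s"
  proof (rule analytic_continuation_open[where s = ?A and s' = ?H and z = s and
        f = "dirichlet_series (dirichlet_conv F G)" and
        g = "\<lambda>s. dirichlet_series (pointwise_prod F G) (2 * s) *
                dirichlet_series (unitary_conv F G) s"])
    show "dirichlet_series (dirichlet_conv F G) holomorphic_on ?H"
      using assms(5) by (rule dirichlet_series_holomorphic)
    show "(\<lambda>s. dirichlet_series (pointwise_prod F G) (2 * s) * dirichlet_series (unitary_conv F G) s)
        holomorphic_on ?H"
      using assms(7) by (intro holomorphic_on_mult P dirichlet_series_holomorphic)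
    have "of_real (\<sigma> + 3) \<in> ?A" by simp
    then show "?A \<noteq> {}" by blast
    fix z assume "z \<in> ?A"
    moreover have "\<sigma> < Re (of_real (\<sigma> + 1) :: complex)" by simp
    ultimately show "dirichlet_series (dirichlet_conv F G) z =
        dirichlet_series (pointwise_prod F G) (2 * z) * dirichlet_series (unitary_conv F G) z"
      using assms(1-4)
      by (intro dirichlet_conv_series_if_abs_summable
          dirichlet_term_abs_summable[where ?s0.0 = "of_real (\<sigma> + 1)"]) auto
  qed (use s in \<open>auto simp: open_halfspace_Re_gt connected_halfspace_Re_gt\<close>)
qed

end
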